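(* Let $\mathcal X=\{A_1,\dots,A_N\}$ be a collection of real matrices in $\mathbb{R}^{d_1\times d_2}$ with $\|A_i\|\le\sigma$ for all $i$, for some $\sigma>0$, and let $\mu=\frac1N\sum_{i=1}^NA_i$. Let $1\le n<N$ and let $X_1,\dots,X_n$ be drawn from $\mathcal X$ by sampling without replacement. Then for every $\epsilon>0$, $$P\Big(\Big\|\frac1n\sum_{i=1}^nX_i-\mu\Big\|\ge\epsilon\Big)\le2(d_1+d_2)\exp\Big(-\frac{n\epsilon^2}{8\sigma^2(1+1/n)(1-n/N)}\Big).$$
   Context: $\|\cdot\|$ is the spectral norm. Sampling without replacement: $(X_1,\dots,X_n)=(A_{\pi(1)},\dots,A_{\pi(n)})$ where $\pi$ is a uniformly random permutation of $\{1,\dots,N\}$. *)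

theory Defs
  imports "HOL-Analysis.Analysis" "HOL-Probability.Probability"
begin

definition spectral_norm :: "real^'d2^'d1 \<Rightarrow> real" where
  "spectral_norm M = onorm (\<lambda>x. M *v x)"

definition unif_perm :: "nat \<Rightarrow> (nat \<Rightarrow> nat) pmf" where
  "unif_perm N = pmf_of_set {\<pi>. \<pi> permutes {..<N}}"

end

theory Submission
  imports Defs
begin

text \<open>
  The running mean \<open>M\<^sub>j\<close> of the first \<open>j\<close> samples, followed from \<open>j = N\<close> down to \<open>j = n\<close>, is a
  reverse martingale started at \<open>\<mu>\<close>: \<open>M\<^sub>j - M\<^sub>j\<^sub>+\<^sub>1 = (M\<^sub>j\<^sub>+\<^sub>1 - X\<^sub>j\<^sub>+\<^sub>1) / j\<close>, where
  \<open>X\<^sub>j\<^sub>+\<^sub>1\<close> is uniform among the first \<open>j + 1\<close> samples. Its increments have norm at most \<open>2\<sigma>/j\<close>, and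
  \<open>\<Sum>\<^sub>n\<^sub>\<le>\<^sub>j\<^sub><\<^sub>N 1/j\<^sup>2 \<le> (1 + 1/n)(1/n - 1/N)\<close> by telescoping.

  After passing to symmetric matrices by the Hermitian dilation, Gaussian bounds on the even trace
  moments \<open>tr H\<^sup>2\<^sup>p\<close> are propagated through the martingale. A step is controlled by Taylor expansion
  along \<open>S + tX\<close>: the first-order term averages to zero, and the second derivative is a sum of
  terms \<open>tr (X H\<^sup>a X H\<^sup>b)\<close>, each at most \<open>\<parallel>X\<parallel>\<^sup>2 tr H\<^sup>a\<^sup>+\<^sup>b\<close>. No matrix exponential, and hence
  no trace inequality of Golden--Thompson or Lieb type, is needed.
\<close>

section \<open>Matrix algebra, trace and Frobenius norm\<close>

lemma bounded_bilinear_matrix_matrix_mult: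
  "bounded_bilinear ((**) :: real^'n^'m \<Rightarrow> real^'k^'n \<Rightarrow> real^'k^'m)"
  unfolding bilinear_conv_bounded_bilinear[symmetric] bilinear_def
  by (auto intro!: linearI simp: vec_eq_iff matrix_matrix_mult_def algebra_simps
      sum.distrib sum_distrib_left)

lemma bounded_linear_trace: "bounded_linear (trace :: real^'n^'n \<Rightarrow> real)"
  unfolding linear_conv_bounded_linear[symmetric]
  by (rule linearI) (auto simp: trace_def sum.distrib sum_distrib_left)

lemmas matrix_mult_sum_right = bounded_bilinear.sum_right[OF bounded_bilinear_matrix_matrix_mult]
lemmas matrix_mult_sum_left = bounded_bilinear.sum_left[OF bounded_bilinear_matrix_matrix_mult]
lemmas trace_sum = linear_sum[OF bounded_linear.linear[OF bounded_linear_trace]]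

text \<open>The inner product of nested vector types is the Frobenius one, so \<open>norm\<close> of
  a matrix is its Frobenius norm. Operator norm bounds therefore appear in the form
  \<open>norm (X *v v) \<le> c * norm v\<close>.\<close>

lemma trace_transpose_mult: "trace (transpose A ** B) = (A :: real^'n^'m) \<bullet> B"
  unfolding trace_def inner_vec_def transpose_def matrix_matrix_mult_def
  by simp (rule sum.swap)

lemma transpose_add: "transpose (A + B) = transpose A + transpose B"
  by (simp add: transpose_def vec_eq_iff)

lemma norm_transpose: "norm (transpose A) = norm (A :: real^'n^'m)"
proof -
  have "transpose A \<bullet> transpose A = A \<bullet> A"
    unfolding trace_transpose_mult[symmetric] by (simp only: transpose_transpose) (rule trace_mul_sym)
  then show ?thesis by (simp add: norm_eq_sqrt_inner)
qed

lemma norm_matrix_vector_mult_le: "norm (A *v x) \<le> norm A * norm (x :: real^'n)"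
  for A :: "real^'n^'m"
proof (rule power2_le_imp_le)
  have "(norm (A *v x))\<^sup>2 = (\<Sum>i\<in>UNIV. (A $ i \<bullet> x)\<^sup>2)"
    unfolding power2_norm_eq_inner inner_vec_def[of "A *v x"]
    by (simp add: matrix_mult_dot power2_eq_square)
  also have "\<dots> \<le> (\<Sum>i\<in>UNIV. (norm (A $ i))\<^sup>2 * (norm x)\<^sup>2)"
    by (intro sum_mono) (simp add: Cauchy_Schwarz_ineq power2_norm_eq_inner)
  also have "\<dots> = (norm A * norm x)\<^sup>2"
    unfolding power_mult_distrib sum_distrib_right[symmetric]
    unfolding power2_norm_eq_inner inner_vec_def[of A] ..
  finally show "(norm (A *v x))\<^sup>2 \<le> (norm A * norm x)\<^sup>2" .
qed simp

text \<open>The columns of \<open>X ** Y\<close> are the images under \<open>X\<close> of the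
  columns of \<open>Y\<close>, and squared Frobenius norms add up over columns.\<close>

lemma norm_matrix_mult_le:
  fixes X :: "real^'n^'m" and Y :: "real^'k^'n"
  assumes "\<And>v. norm (X *v v) \<le> c * norm v" and "0 \<le> c"
  shows "norm (X ** Y) \<le> c * norm Y"
proof (rule power2_le_imp_le)
  have columns: "(norm Z)\<^sup>2 = (\<Sum>j\<in>UNIV. (norm (column j Z))\<^sup>2)" for Z :: "real^'k^'l"
    unfolding norm_transpose[of Z, symmetric] power2_norm_eq_inner inner_vec_def[of "transpose Z"]
    by (simp add: transpose_def column_def)
  have "(norm (X ** Y))\<^sup>2 = (\<Sum>j\<in>UNIV. (norm (X *v column j Y))\<^sup>2)"
    unfolding columns by (simp add: column_def matrix_matrix_mult_def matrix_vector_mult_def)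
  also have "\<dots> \<le> (\<Sum>j\<in>UNIV. (c * norm (column j Y))\<^sup>2)"
    by (intro sum_mono power_mono assms) simp
  also have "\<dots> = (c * norm Y)\<^sup>2"
    by (simp add: columns power_mult_distrib sum_distrib_left)
  finally show "(norm (X ** Y))\<^sup>2 \<le> (c * norm Y)\<^sup>2" .
qed (simp add: assms(2))

section \<open>Powers of symmetric matrices\<close>

primrec mpow :: "real^'n^'n \<Rightarrow> nat \<Rightarrow> real^'n^'n" where
  "mpow H 0 = mat 1"
| "mpow H (Suc k) = H ** mpow H k"

lemma mpow_add: "mpow H (j + k) = mpow H j ** mpow H k"
  by (induction j) (simp_all add: matrix_mul_assoc)

lemma mpow_commute: "H ** mpow H k = mpow H k ** H"
  using mpow_add[of H k 1] mpow_add[of H 1 k] by (simp add: add.commute)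

lemma transpose_mpow: "transpose H = H \<Longrightarrow> transpose (mpow H k) = mpow H k"
  by (induction k) (simp_all add: matrix_transpose_mul mpow_commute)

text \<open>This makes even trace moments nonnegative and lets Cauchy-Schwarz act on them.\<close>

lemma trace_mpow_even:
  assumes "transpose H = H"
  shows "trace (mpow H (2 * p)) = (norm (mpow H p))\<^sup>2"
  using trace_transpose_mult[of "mpow H p" "mpow H p"] assms
  by (simp add: transpose_mpow mpow_add[symmetric] power2_norm_eq_inner mult_2)

text \<open>Discrete maximum principle: a convex sequence attains its maximum over
  \<open>{..q}\<close> at an end point.\<close>

lemma convex_seq_le_endpoints:
  fixes f :: "nat \<Rightarrow> real"
  assumes convex: "\<And>r. Suc r < q \<Longrightarrow> 2 * f (Suc r) \<le> f r + f (Suc (Suc r))"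
    and "f q \<le> f 0" and "r \<le> q"
  shows "f r \<le> f 0"
proof -
  define m where "m = Max (f ` {..q})"
  have le_m: "f s \<le> m" if "s \<le> q" for s
    using that by (simp add: m_def)
  \<comment> \<open>The leftmost maximiser is strictly above its left neighbour, which convexity
    forbids at an interior index.\<close>
  define r0 where "r0 = (LEAST s. s \<le> q \<and> f s = m)"
  have "m \<in> f ` {..q}"
    unfolding m_def by (rule Max_in) auto
  then obtain s where "s \<le> q \<and> f s = m" by auto
  then have "r0 \<le> q \<and> f r0 = m"
    unfolding r0_def by (rule LeastI)
  then have r0: "r0 \<le> q" "f r0 = m" by auto
  have least: "f s \<noteq> m" if "s < r0" for s
    using not_less_Least[of s "\<lambda>s. s \<le> q \<and> f s = m"] that r0(1) unfolding r0_def by auto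
  have "m \<le> f 0"
  proof (cases "r0 = 0 \<or> r0 = q")
    case True
    then show ?thesis using r0 assms(2) by auto
  next
    case False
    then obtain t where t: "r0 = Suc t" "Suc t < q"
      using r0(1) by (cases r0) auto
    have "f t < m"
      using least[of t] le_m[of t] t by fastforce
    moreover have "f (Suc (Suc t)) \<le> m"
      using le_m t by simp
    ultimately show ?thesis
      using convex[of t] t r0(2) by simp
  qed
  then show ?thesis using le_m[OF \<open>r \<le> q\<close>] by simp
qed

text \<open>Both sides are Frobenius inner products of the matrices \<open>H\<^sup>r X H\<^sup>s\<close> with \<open>r + s = q\<close>,
  whose norms are convex in \<open>r\<close> by Cauchy--Schwarz, hence maximal at an end point.\<close>

lemma trace_mpow_sandwich_le:
  fixes H X :: "real^'n^'n"
  assumes H: "transpose H = H" and X: "transpose X = X"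
    and c: "\<And>v. norm (X *v v) \<le> c * norm v" "0 \<le> c"
    and ab: "a + b = 2 * q"
  shows "trace (X ** mpow H a ** X ** mpow H b) \<le> c\<^sup>2 * trace (mpow H (2 * q))"
proof -
  define W where "W r = mpow H r ** X ** mpow H (q - r)" for r
  \<comment> \<open>The value depends on \<open>r + s\<close> only, so the index pairs (r+1, r+1)
    and (r, r+2) agree. Cauchy-Schwarz on the second pair makes the norms log-convex, and the
    inequality of arithmetic and geometric means then makes them convex.\<close>
  have inner_W: "W r \<bullet> W s = trace (X ** mpow H (r + s) ** X ** mpow H (2 * q - (r + s)))"
    if "r \<le> q" "s \<le> q" for r s
  proof -
    have "W r \<bullet> W s = trace (mpow H (q - r) ** (X ** mpow H (r + s) ** X ** mpow H (q - s)))"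
      unfolding trace_transpose_mult[symmetric] W_def
      by (simp add: matrix_transpose_mul transpose_mpow H X matrix_mul_assoc mpow_add)
    also have "\<dots> = trace (X ** mpow H (r + s) ** X ** mpow H ((q - s) + (q - r)))"
      unfolding mpow_add by (subst trace_mul_sym) (simp add: matrix_mul_assoc mpow_add)
    also have "(q - s) + (q - r) = 2 * q - (r + s)"
      using that by simp
    finally show ?thesis .
  qed
  have W_le: "norm (W r) \<le> norm (W 0)" if "r \<le> q" for r
  proof (rule convex_seq_le_endpoints[where f = "\<lambda>r. norm (W r)", OF _ _ that])
    fix r assume "Suc r < q"
    then have "W (Suc r) \<bullet> W (Suc r) = W r \<bullet> W (Suc (Suc r))"
      by (simp add: inner_W)
    also have "\<dots> \<le> norm (W r) * norm (W (Suc (Suc r)))"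
      by (rule norm_cauchy_schwarz)
    finally have "(norm (W (Suc r)))\<^sup>2 \<le> norm (W r) * norm (W (Suc (Suc r)))"
      by (simp add: power2_norm_eq_inner)
    moreover have "4 * (x * y) \<le> (x + y)\<^sup>2" for x y :: real
      using zero_le_power2[of "x - y"] by (simp add: power2_eq_square algebra_simps)
    ultimately have "(2 * norm (W (Suc r)))\<^sup>2 \<le> (norm (W r) + norm (W (Suc (Suc r))))\<^sup>2"
      by (smt (verit) power_mult_distrib four_x_squared)
    then show "2 * norm (W (Suc r)) \<le> norm (W r) + norm (W (Suc (Suc r)))"
      by (rule power2_le_imp_le) simp
  next
    have "W q = transpose (W 0)"
      by (simp add: W_def matrix_transpose_mul transpose_mpow H X)
    then show "norm (W q) \<le> norm (W 0)"
      by (simp add: norm_transpose)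
  qed
  \<comment> \<open>Any splitting of \<open>a\<close> into two indices at most \<open>q\<close>
    would do; one exists because \<open>a \<le> 2 * q\<close>.\<close>
  define r where "r = min a q"
  have r: "r \<le> q" "a - r \<le> q" "r + (a - r) = a" "2 * q - a = b"
    using ab by (auto simp: r_def)
  have "trace (X ** mpow H a ** X ** mpow H b) = W r \<bullet> W (a - r)"
    using inner_W[OF r(1,2)] r(3,4) by simp
  also have "\<dots> \<le> norm (W r) * norm (W (a - r))"
    by (rule norm_cauchy_schwarz)
  also have "\<dots> \<le> (norm (W 0))\<^sup>2"
    unfolding power2_eq_square by (intro mult_mono W_le r) simp_all
  also have "\<dots> \<le> (c * norm (mpow H q))\<^sup>2"
    unfolding W_def using norm_matrix_mult_le[OF c, of "mpow H q"] by (intro power_mono) simp_all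
  also have "\<dots> = c\<^sup>2 * trace (mpow H (2 * q))"
    by (simp add: trace_mpow_even H power_mult_distrib)
  finally show ?thesis .
qed

text \<open>By symmetry of \<open>H\<close> and Cauchy-Schwarz, the norms of the iterates of
  \<open>v\<close> under \<open>H\<close> form a log-convex sequence. This replaces diagonalisation
  when the operator norm is compared with powers.\<close>

lemma norm_mpow_vector_ge:
  fixes H :: "real^'n^'n"
  assumes H: "transpose H = H"
  shows "norm (H *v v) ^ Suc k \<le> norm (mpow H (Suc k) *v v) * norm v ^ k"
proof -
  define a where "a k = norm (mpow H k *v v)" for k
  have logconvex: "(a (Suc k))\<^sup>2 \<le> a k * a (Suc (Suc k))" for k
  proof -
    have "(mpow H (Suc k) *v v) \<bullet> (mpow H (Suc k) *v v)
        = (mpow H k *v v) \<bullet> (mpow H (Suc (Suc k)) *v v)"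
      by (metis H dot_lmul_matrix matrix_vector_mul_assoc mpow.simps(2) transpose_matrix_vector)
    then show ?thesis
      unfolding a_def power2_norm_eq_inner by (metis norm_cauchy_schwarz)
  qed
  \<comment> \<open>Every ratio of consecutive terms is at least the first one. It is
    cross-multiplied because terms may vanish; multiplying these bounds together gives the
    claim.\<close>
  have ratio: "a 1 * a k \<le> a (Suc k) * a 0" for k
  proof (induction k)
    case (Suc k)
    show ?case
    proof (cases "a k = 0")
      case True
      then have "a (Suc k) = 0"
        by (simp add: a_def matrix_vector_mul_assoc[symmetric])
      then show ?thesis by (simp add: a_def)
    next
      case False
      then have "0 < a k" by (simp add: a_def)
      have "a 1 * a (Suc k) * a k \<le> a (Suc k) * a 0 * a (Suc k)"
        using mult_right_mono[OF Suc.IH, of "a (Suc k)"] by (simp add: a_def mult_ac)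
      also have "\<dots> \<le> a 0 * (a k * a (Suc (Suc k)))"
        using mult_left_mono[OF logconvex, of "a 0" k]
        by (simp add: a_def power2_eq_square mult_ac)
      finally show ?thesis
        using \<open>0 < a k\<close> by (simp add: mult_ac)
    qed
  qed (simp add: mult.commute)
  have "a 1 ^ Suc k \<le> a (Suc k) * a 0 ^ k" for k
  proof (induction k)
    case (Suc k)
    have "a 1 ^ Suc (Suc k) \<le> a 1 * (a (Suc k) * a 0 ^ k)"
      using mult_left_mono[OF Suc.IH, of "a 1"] by (simp add: a_def)
    also have "\<dots> \<le> a (Suc (Suc k)) * a 0 * a 0 ^ k"
      using mult_right_mono[OF ratio[of "Suc k"], of "a 0 ^ k"] by (simp add: a_def mult_ac)
    finally show ?case by (simp add: mult_ac)
  qed simp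
  then show ?thesis
    by (simp add: a_def)
qed

section \<open>Derivatives of trace moments along a line\<close>

lemma has_vector_derivative_mpow_line:
  fixes S X :: "real^'n^'n"
  shows "((\<lambda>t. mpow (S + t *\<^sub>R X) k) has_vector_derivative
    (\<Sum>a<k. mpow (S + t *\<^sub>R X) a ** X ** mpow (S + t *\<^sub>R X) (k - Suc a))) (at t)"
proof (induction k)
  case 0
  show ?case by simp
next
  case (Suc k)
  let ?H = "S + t *\<^sub>R X"
  have line: "((\<lambda>t. S + t *\<^sub>R X) has_vector_derivative X) (at t)"
    by (auto intro!: derivative_eq_intros)
  have "((\<lambda>t. (S + t *\<^sub>R X) ** mpow (S + t *\<^sub>R X) k) has_vector_derivative
      ?H ** (\<Sum>a<k. mpow ?H a ** X ** mpow ?H (k - Suc a)) + X ** mpow ?H k) (at t)"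
    by (rule bounded_bilinear.has_vector_derivative[OF bounded_bilinear_matrix_matrix_mult line Suc.IH])
  moreover have "?H ** (\<Sum>a<k. mpow ?H a ** X ** mpow ?H (k - Suc a)) + X ** mpow ?H k
      = (\<Sum>a<Suc k. mpow ?H a ** X ** mpow ?H (Suc k - Suc a))"
    unfolding sum.lessThan_Suc_shift
    by (simp add: matrix_mult_sum_right matrix_mul_assoc)
  ultimately show ?case by simp
qed

text \<open>The factor \<open>Y\<close> serves two purposes: \<open>mat 1\<close> yields the first
  derivative of a trace moment, and \<open>Y = X\<close> the second.\<close>

lemma has_real_derivative_trace_mult_mpow_line:
  fixes S X Y :: "real^'n^'n"
  shows "((\<lambda>t. trace (Y ** mpow (S + t *\<^sub>R X) k)) has_real_derivative
    (\<Sum>a<k. trace (Y ** mpow (S + t *\<^sub>R X) a ** X ** mpow (S + t *\<^sub>R X) (k - Suc a)))) (at t)"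
proof -
  have "bounded_linear (\<lambda>Z. trace (Y ** Z))"
    using bounded_linear_compose[OF bounded_linear_trace
        bounded_bilinear.bounded_linear_right[OF bounded_bilinear_matrix_matrix_mult, of Y]] .
  from bounded_linear.has_vector_derivative[OF this has_vector_derivative_mpow_line[of S X k t]]
  show ?thesis
    by (simp add: has_real_derivative_iff_has_vector_derivative matrix_mult_sum_right trace_sum
        matrix_mul_assoc)
qed

text \<open>Cyclicity of the trace makes all \<open>Suc k\<close> terms of the noncommutative
  product rule equal.\<close>

lemma has_real_derivative_trace_mpow_line:
  fixes S X :: "real^'n^'n"
  shows "((\<lambda>t. trace (mpow (S + t *\<^sub>R X) (Suc k))) has_real_derivative
    real (Suc k) * trace (X ** mpow (S + t *\<^sub>R X) k)) (at t)"
proof -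
  let ?H = "S + t *\<^sub>R X"
  have "trace (mpow ?H a ** X ** mpow ?H (k - a)) = trace (X ** mpow ?H k)" if "a < Suc k" for a
  proof -
    have "trace (mpow ?H a ** X ** mpow ?H (k - a)) = trace (X ** (mpow ?H (k - a) ** mpow ?H a))"
      by (metis matrix_mul_assoc trace_mul_sym)
    then show ?thesis
      using that by (simp add: mpow_add[symmetric])
  qed
  then have "(\<Sum>a<Suc k. trace (mpow ?H a ** X ** mpow ?H (k - a)))
      = (\<Sum>a<Suc k. trace (X ** mpow ?H k))"
    by (intro sum.cong) auto
  then show ?thesis
    using has_real_derivative_trace_mult_mpow_line[of "mat 1" S X "Suc k" t]
    by (simp del: mpow.simps(2) sum.lessThan_Suc)
qed

section \<open>Gaussian moment bounds through a martingale step\<close>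

definition gaussian_moment :: "nat \<Rightarrow> real" where
  "gaussian_moment p = fact (2 * p) / (2 ^ p * fact p)"

lemma gaussian_moment_0 [simp]: "gaussian_moment 0 = 1"
  by (simp add: gaussian_moment_def)

text \<open>\<open>gaussian_moment p\<close> is the double factorial (2p-1)!!, the 2p-th moment of a
  standard normal variable. The factor \<open>2 * real p + 1\<close> matches the number of terms in
  the second derivative of the next even trace moment.\<close>

lemma gaussian_moment_Suc: "gaussian_moment (Suc p) = (2 * real p + 1) * gaussian_moment p"
proof -
  have "fact (2 * Suc p) = 2 * (1 + real p) * (2 * real p + 1) * fact (2 * p)"
    by (simp add: algebra_simps)
  then show ?thesis
    unfolding gaussian_moment_def by (simp add: divide_simps del: fact_Suc) simp
qed

lemma gaussian_moment_nonneg: "0 \<le> gaussian_moment p"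
  by (simp add: gaussian_moment_def)

lemma has_real_derivative_power_affine_square:
  "((\<lambda>t::real. (v + b * t\<^sup>2) ^ k) has_real_derivative
    real k * (v + b * t\<^sup>2) ^ (k - 1) * (2 * b * t)) (at t)"
  by (auto intro!: derivative_eq_intros)

text \<open>Along \<open>t \<mapsto> S + tX\<close> the \<open>2p\<close>-th trace moment has second derivative at most
  \<open>2p(2p-1)c\<^sup>2\<close> times the \<open>(2p-2)\<close>-th one, and \<open>(v + c\<^sup>2t\<^sup>2)\<^sup>p\<close> times the Gaussian moment
  satisfies the reverse inequality.\<close>

lemma trace_moment_martingale_step:
  fixes S X :: "'i \<Rightarrow> real^'n^'n"
  assumes "finite I"
    and S: "\<And>i. i \<in> I \<Longrightarrow> transpose (S i) = S i"
    and X: "\<And>i. i \<in> I \<Longrightarrow> transpose (X i) = X i"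
    and X_le: "\<And>i u. i \<in> I \<Longrightarrow> norm (X i *v u) \<le> c * norm u"
    and "0 \<le> c" and "0 \<le> v"
    and centered: "\<And>k. (\<Sum>i\<in>I. trace (X i ** mpow (S i) k)) = 0"
    and moments: "\<And>p. (\<Sum>i\<in>I. trace (mpow (S i) (2 * p))) \<le> K * gaussian_moment p * v ^ p"
    and "0 \<le> t"
  shows "(\<Sum>i\<in>I. trace (mpow (S i + t *\<^sub>R X i) (2 * p)))
    \<le> K * gaussian_moment p * (v + c\<^sup>2 * t\<^sup>2) ^ p"
  using \<open>0 \<le> t\<close>
proof (induction p arbitrary: t)
  case 0
  then show ?case using moments[of 0] by simp
next
  case (Suc p)
  \<comment> \<open>The zeroth moments are traces of the identity, which forces \<open>K\<close> to
    be nonnegative.\<close>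
  have "0 \<le> (\<Sum>i\<in>I. trace (mpow (S i) (2 * 0)))"
    by (simp add: trace_I)
  with moments[of 0] have "0 \<le> K" by simp
  let ?H = "\<lambda>i t. S i + t *\<^sub>R X i"
  let ?w = "\<lambda>t. v + c\<^sup>2 * t\<^sup>2"
  define C where "C = K * gaussian_moment (Suc p)"
  have "0 \<le> C"
    unfolding C_def using \<open>0 \<le> K\<close> gaussian_moment_nonneg by simp
  \<comment> \<open>The gap between bound and moment. It is nonnegative at 0 by
    \<open>moments\<close>, has zero slope there by \<open>centered\<close>, and is convex for
    \<open>t \<ge> 0\<close> by the induction hypothesis.\<close>
  define \<psi> where
    "\<psi> t = C * ?w t ^ Suc p - (\<Sum>i\<in>I. trace (mpow (?H i t) (2 * Suc p)))" for t
  define \<psi>' where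
    "\<psi>' t = C * (real (Suc p) * ?w t ^ p * (2 * c\<^sup>2 * t))
      - (\<Sum>i\<in>I. real (2 * Suc p) * trace (X i ** mpow (?H i t) (2 * p + 1)))" for t
  define \<psi>'' where
    "\<psi>'' t = C * real (Suc p) * (real p * ?w t ^ (p - 1) * (2 * c\<^sup>2 * t)\<^sup>2 + ?w t ^ p * (2 * c\<^sup>2))
      - (\<Sum>i\<in>I. real (2 * Suc p) *
          (\<Sum>a<2 * p + 1. trace (X i ** mpow (?H i t) a ** X i ** mpow (?H i t) (2 * p + 1 - Suc a))))"
    for t
  have D1: "(\<psi> has_real_derivative \<psi>' t) (at t)" for t
  proof -
    have "((\<lambda>t. trace (mpow (?H i t) (2 * Suc p))) has_real_derivative
        real (2 * Suc p) * trace (X i ** mpow (?H i t) (2 * p + 1))) (at t)" for i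
      using has_real_derivative_trace_mpow_line[of "S i" "X i" "2 * p + 1" t]
      by (simp del: mpow.simps)
    then show ?thesis
      unfolding \<psi>_def[abs_def] \<psi>'_def
      using has_real_derivative_power_affine_square[of v "c\<^sup>2" "Suc p" t]
      by (intro DERIV_diff DERIV_sum DERIV_cmult) simp_all
  qed
  have D2: "(\<psi>' has_real_derivative \<psi>'' t) (at t)" for t
  proof -
    have "((\<lambda>t. C * real (Suc p) * (?w t ^ p * (2 * c\<^sup>2 * t))) has_real_derivative
      C * real (Suc p) * (real p * ?w t ^ (p - 1) * (2 * c\<^sup>2 * t) * (2 * c\<^sup>2 * t)
        + 2 * c\<^sup>2 * ?w t ^ p)) (at t)"
      by (intro DERIV_cmult DERIV_mult has_real_derivative_power_affine_square)
        (auto intro!: derivative_eq_intros)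
    then have "((\<lambda>t. C * (real (Suc p) * ?w t ^ p * (2 * c\<^sup>2 * t))) has_real_derivative
      C * real (Suc p) * (real p * ?w t ^ (p - 1) * (2 * c\<^sup>2 * t)\<^sup>2 + ?w t ^ p * (2 * c\<^sup>2))) (at t)"
      by (simp only: power2_eq_square mult_ac)
    then show ?thesis
      unfolding \<psi>'_def[abs_def] \<psi>''_def
      by (intro DERIV_diff DERIV_sum DERIV_cmult has_real_derivative_trace_mult_mpow_line)
  qed
  have \<psi>''_nonneg: "0 \<le> \<psi>'' t" if "0 \<le> t" for t
  proof -
    \<comment> \<open>In each term the two exponents of \<open>?H i t\<close> sum to
      \<open>2 * p\<close>, so the sandwich bound leads to the moment covered by the induction
      hypothesis.\<close>
    have "(\<Sum>i\<in>I. real (2 * Suc p) *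
          (\<Sum>a<2 * p + 1. trace (X i ** mpow (?H i t) a ** X i ** mpow (?H i t) (2 * p + 1 - Suc a))))
        \<le> (\<Sum>i\<in>I. real (2 * Suc p) * (\<Sum>a<2 * p + 1. c\<^sup>2 * trace (mpow (?H i t) (2 * p))))"
      by (intro sum_mono mult_left_mono trace_mpow_sandwich_le)
        (auto simp: transpose_scalar transpose_add S X X_le \<open>0 \<le> c\<close>)
    also have "\<dots> = real (2 * Suc p) * (2 * real p + 1) * c\<^sup>2 * (\<Sum>i\<in>I. trace (mpow (?H i t) (2 * p)))"
      by (simp add: sum_distrib_left ac_simps)
    also have "\<dots> \<le> real (2 * Suc p) * (2 * real p + 1) * c\<^sup>2 * (K * gaussian_moment p * ?w t ^ p)"
      by (intro mult_left_mono Suc.IH that) simp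
    also have "\<dots> = C * real (Suc p) * (?w t ^ p * (2 * c\<^sup>2))"
      by (simp add: C_def gaussian_moment_Suc mult_ac)
    \<comment> \<open>The added term is nonnegative; at \<open>p = 0\<close> the truncated exponent
      \<open>p - 1\<close> is neutralised by the factor \<open>real p\<close>.\<close>
    also have "\<dots> \<le> C * real (Suc p) *
        (real p * ?w t ^ (p - 1) * (2 * c\<^sup>2 * t)\<^sup>2 + ?w t ^ p * (2 * c\<^sup>2))"
      using \<open>0 \<le> C\<close> \<open>0 \<le> v\<close> by (intro mult_left_mono) simp_all
    finally show ?thesis by (simp add: \<psi>''_def)
  qed
  have "\<psi>' 0 = 0"
    by (simp add: \<psi>'_def sum_distrib_left[symmetric] centered del: mpow.simps)
  have \<psi>'_nonneg: "0 \<le> \<psi>' s" if "0 \<le> s" for s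
    using DERIV_nonneg_imp_nondecreasing[OF that, of \<psi>'] D2 \<psi>''_nonneg \<open>\<psi>' 0 = 0\<close> by force
  have "0 \<le> \<psi> 0"
    using moments[of "Suc p"] by (simp add: \<psi>_def C_def)
  also have "\<psi> 0 \<le> \<psi> t"
    using DERIV_nonneg_imp_nondecreasing[OF Suc.prems, of \<psi>] D1 \<psi>'_nonneg by blast
  finally show ?case by (simp add: \<psi>_def C_def)
qed

section \<open>From trace moments to tail bounds\<close>

lemma trace_mpow_ge_onorm:
  fixes H :: "real^'n^'n"
  assumes H: "transpose H = H" and "0 \<le> \<epsilon>" and "\<epsilon> \<le> onorm ((*v) H)"
  shows "\<epsilon> ^ (2 * p) \<le> trace (mpow H (2 * p))"
proof (cases p)
  case 0
  have "1 \<le> CARD('n)" by (simp add: Suc_leI)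
  then show ?thesis by (simp add: 0 trace_I)
next
  case (Suc k)
  \<comment> \<open>The p-th root of the Frobenius norm of the p-th power bounds the operator norm
    of \<open>H\<close>.\<close>
  define K where "K = root p (norm (mpow H p))"
  have "0 < p" using Suc by simp
  then have K: "0 \<le> K" "K ^ p = norm (mpow H p)"
    by (simp_all add: K_def)
  have "norm (H *v v) \<le> K * norm v" for v
  proof -
    have "norm (H *v v) ^ p \<le> norm (mpow H p *v v) * norm v ^ k"
      using norm_mpow_vector_ge[OF H] unfolding Suc by blast
    also have "\<dots> \<le> norm (mpow H p) * norm v * norm v ^ k"
      by (intro mult_right_mono norm_matrix_vector_mult_le) simp
    also have "\<dots> = (K * norm v) ^ p"
      unfolding power_mult_distrib K(2) by (simp add: Suc)
    finally show ?thesis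
      using \<open>0 < p\<close> K(1) by (simp add: power_mono_iff)
  qed
  then have "\<epsilon> \<le> K"
    using onorm_le[of "(*v) H" K] assms(3) by simp
  then have "\<epsilon> ^ p \<le> norm (mpow H p)"
    using \<open>0 \<le> \<epsilon>\<close> K(2) power_mono by metis
  then show ?thesis
    using power_mono[of "\<epsilon> ^ p" "norm (mpow H p)" 2] \<open>0 \<le> \<epsilon>\<close>
    by (simp add: trace_mpow_even[OF H] power_even_eq)
qed

text \<open>The moment bounds are summed against the series of \<open>cosh (\<theta>\<epsilon>)\<close> with \<open>\<theta> = \<epsilon>/v\<close>;
  the factor 2 is lost in \<open>exp \<le> 2 cosh\<close>.\<close>

lemma gaussian_moments_imp_tail:
  fixes P \<epsilon> v D :: real
  assumes moments: "\<And>p. P * \<epsilon> ^ (2 * p) \<le> D * gaussian_moment p * v ^ p"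
    and "0 < v" and "0 \<le> P"
  shows "P \<le> 2 * D * exp (- \<epsilon>\<^sup>2 / (2 * v))"
proof -
  \<comment> \<open>This value minimises the final exponent \<theta>^2 v / 2 - \<theta>
    \<epsilon>.\<close>
  define \<theta> where "\<theta> = \<epsilon> / v"
  have "(\<lambda>n. if even n then (\<theta> * \<epsilon>) ^ n /\<^sub>R fact n else 0) sums cosh (\<theta> * \<epsilon>)"
    by (rule cosh_converges)
  then have "(\<lambda>p. (\<theta> * \<epsilon>) ^ (2 * p) /\<^sub>R fact (2 * p)) sums cosh (\<theta> * \<epsilon>)"
    by (subst (asm) sums_mono_reindex[of "\<lambda>p. 2 * p", symmetric])
      (auto simp: strict_mono_def elim!: evenE)
  then have lower: "(\<lambda>p. P * ((\<theta> * \<epsilon>) ^ (2 * p) /\<^sub>R fact (2 * p))) sums (P * cosh (\<theta> * \<epsilon>))"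
    by (rule sums_mult)
  have upper: "(\<lambda>p. D * ((\<theta>\<^sup>2 * v / 2) ^ p /\<^sub>R fact p)) sums (D * exp (\<theta>\<^sup>2 * v / 2))"
    by (intro sums_mult exp_converges)
  have "P * cosh (\<theta> * \<epsilon>) \<le> D * exp (\<theta>\<^sup>2 * v / 2)"
  proof (rule sums_le[OF _ lower upper])
    fix p
    have "P * ((\<theta> * \<epsilon>) ^ (2 * p) /\<^sub>R fact (2 * p)) = (P * \<epsilon> ^ (2 * p)) * (\<theta> ^ (2 * p) / fact (2 * p))"
      by (simp add: power_mult_distrib field_simps)
    also have "\<dots> \<le> (D * gaussian_moment p * v ^ p) * (\<theta> ^ (2 * p) / fact (2 * p))"
      by (intro mult_right_mono moments) (simp add: power_mult)
    \<comment> \<open>Dividing the Gaussian moment by \<open>fact (2 * p)\<close> leaves 1 / (2^p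
      p!), a term of the exponential series.\<close>
    also have "\<dots> = D * ((\<theta>\<^sup>2 * v / 2) ^ p /\<^sub>R fact p)"
      by (simp add: gaussian_moment_def power_mult_distrib power_divide field_simps
          flip: power_mult)
    finally show "P * ((\<theta> * \<epsilon>) ^ (2 * p) /\<^sub>R fact (2 * p)) \<le> D * ((\<theta>\<^sup>2 * v / 2) ^ p /\<^sub>R fact p)" .
  qed
  moreover have "P * (exp (\<theta> * \<epsilon>) / 2) \<le> P * cosh (\<theta> * \<epsilon>)"
    using \<open>0 \<le> P\<close> by (intro mult_left_mono) (simp_all add: cosh_def)
  ultimately have "P * exp (\<theta> * \<epsilon>) \<le> 2 * D * exp (\<theta>\<^sup>2 * v / 2)"
    by simp
  then have "P \<le> 2 * D * (exp (\<theta>\<^sup>2 * v / 2) / exp (\<theta> * \<epsilon>))"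
    by (simp add: field_simps)
  also have "exp (\<theta>\<^sup>2 * v / 2) / exp (\<theta> * \<epsilon>) = exp (- \<epsilon>\<^sup>2 / (2 * v))"
    using \<open>0 < v\<close> by (simp add: exp_diff[symmetric] \<theta>_def power2_eq_square field_simps)
  finally show ?thesis .
qed

section \<open>Sampling without replacement as a reverse martingale\<close>

lemma sum_inverse_squares_le:
  fixes n N :: nat
  assumes "1 \<le> n" and "n \<le> N"
  shows "(\<Sum>j = n..<N. 1 / (real j)\<^sup>2) \<le> (1 + 1 / real n) * (1 / real n - 1 / real N)"
proof -
  have "(\<Sum>j = n..<N. 1 / (real j)\<^sup>2)
      \<le> (\<Sum>j = n..<N. (1 + 1 / real n) * (1 / real j - 1 / real (Suc j)))"
  proof (rule sum_mono)
    fix j assume "j \<in> {n..<N}"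
    then have j: "0 < real j" "real n \<le> real j" "0 < real n" using assms by auto
    \<comment> \<open>This exact identity is the source of the factor \<open>1 + 1 / real n\<close>
      in the theorem: its first factor is largest at \<open>j = n\<close>, and the second
      telescopes.\<close>
    have "1 / (real j)\<^sup>2 = (1 + 1 / real j) * (1 / real j - 1 / real (Suc j))"
      using j by (simp add: divide_simps power2_eq_square)
    also have "\<dots> \<le> (1 + 1 / real n) * (1 / real j - 1 / real (Suc j))"
      using j by (intro mult_right_mono) (simp_all add: frac_le)
    finally show "1 / (real j)\<^sup>2 \<le> (1 + 1 / real n) * (1 / real j - 1 / real (Suc j))" .
  qed
  also have "\<dots> = (1 + 1 / real n) * (1 / real n - 1 / real N)"
    using sum_Suc_diff'[OF \<open>n \<le> N\<close>, of "\<lambda>j. - 1 / real j"]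
    unfolding sum_distrib_left[symmetric] by simp
  finally show ?thesis .
qed

lemma linear_transpose: "linear (transpose :: real^'n^'m \<Rightarrow> real^'m^'n)"
  by (rule linearI) (simp_all add: transpose_add transpose_scalar)

lemma sum_matrix_vector_mult: "(\<Sum>i\<in>I. A i) *v u = (\<Sum>i\<in>I. A i *v u)"
  for A :: "'i \<Rightarrow> real^'n^'m"
  by (induction I rule: infinite_finite_induct) (simp_all add: matrix_vector_mult_add_rdistrib)

text \<open>Expectations are written as sums over all permutations, hence \<open>fact N\<close>. The
  induction descends from \<open>N\<close>, where the mean no longer depends on the order; the step
  at \<open>j\<close> adds the squared increment bound (2\<sigma>/j)^2.\<close>

lemma trace_moment_sampling:
  fixes B :: "nat \<Rightarrow> real^'n^'n" and \<sigma> :: real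
  defines "M \<equiv> \<lambda>j \<pi>. (1 / real j) *\<^sub>R (\<Sum>k<j. B (\<pi> k))"
  assumes B: "\<And>i. i < N \<Longrightarrow> transpose (B i) = B i"
    and B_le: "\<And>i u. i < N \<Longrightarrow> norm (B i *v u) \<le> \<sigma> * norm u"
    and "0 \<le> \<sigma>" and "1 \<le> n" and "n \<le> N"
  shows "(\<Sum>\<pi> | \<pi> permutes {..<N}. trace (mpow (M n \<pi> - M N id) (2 * p)))
    \<le> fact N * real CARD('n) * gaussian_moment p * (4 * \<sigma>\<^sup>2 * (\<Sum>j = n..<N. 1 / (real j)\<^sup>2)) ^ p"
  using \<open>n \<le> N\<close>
proof (induction n arbitrary: p rule: inc_induct)
  case base
  have "M N \<pi> - M N id = 0" if "\<pi> permutes {..<N}" for \<pi>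
    using sum.permute[OF that, of B] by (simp add: M_def o_def)
  then have "(\<Sum>\<pi> | \<pi> permutes {..<N}. trace (mpow (M N \<pi> - M N id) (2 * p)))
      = (\<Sum>\<pi> | \<pi> permutes {..<N}. trace (mpow (0 :: real^'n^'n) (2 * p)))"
    by (intro sum.cong refl arg_cong[where f = "\<lambda>Z. trace (mpow Z (2 * p))"]) blast
  also have "\<dots> = fact N * trace (mpow (0 :: real^'n^'n) (2 * p))"
    by (simp add: card_permutations[OF card_lessThan])
  also have "\<dots> \<le> fact N * real CARD('n) * gaussian_moment p
      * (4 * \<sigma>\<^sup>2 * (\<Sum>j = N..<N. 1 / (real j)\<^sup>2)) ^ p"
    by (cases p) (simp_all add: trace_I trace_0[simplified])
  finally show ?case .
next
  case (step j)
  have "1 \<le> j" "j < N" using step.hyps \<open>1 \<le> n\<close> by auto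
  have \<pi>_less: "\<pi> k < N" if "\<pi> permutes {..<N}" "k < N" for \<pi> k
    using permutes_in_image[OF that(1)] that(2) by simp
  define Perms where "Perms = {\<pi>. \<pi> permutes {..<N}}"
  have "finite Perms" by (simp add: Perms_def finite_permutations)
  \<comment> \<open>A pair consists of a permutation and the position \<open>i\<close> of the sample
    to be dropped, uniform among the first \<open>j + 1\<close>. The redundant choice contributes a
    factor \<open>Suc j\<close> that cancels at the end.\<close>
  define I where "I = Perms \<times> {..j}"
  define S where "S = (\<lambda>(\<pi>, i::nat). M (Suc j) \<pi> - M N id)"
  define X where "X = (\<lambda>(\<pi>, i). (1 / real j) *\<^sub>R (M (Suc j) \<pi> - B (\<pi> i)))"
  have M_sym: "transpose (M k \<pi>) = M k \<pi>" if "\<pi> permutes {..<N}" "k \<le> N" for k \<pi>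
    unfolding M_def using that
    by (auto simp: transpose_scalar linear_sum[OF linear_transpose] B \<pi>_less intro!: sum.cong)
  have M_le: "norm (M k \<pi> *v u) \<le> \<sigma> * norm u" if "\<pi> permutes {..<N}" "1 \<le> k" "k \<le> N" for k \<pi> u
  proof -
    have "norm (\<Sum>i<k. B (\<pi> i) *v u) \<le> (\<Sum>i<k. \<sigma> * norm u)"
      using that by (intro sum_norm_le) (simp add: B_le \<pi>_less)
    then show ?thesis
      using that(2) by (simp add: M_def scaleR_matrix_vector_assoc[symmetric]
          sum_matrix_vector_mult field_simps)
  qed
  have "(\<Sum>\<iota>\<in>I. trace (mpow (S \<iota> + 1 *\<^sub>R X \<iota>) (2 * p)))
      \<le> (fact N * real CARD('n) * real (Suc j)) * gaussian_moment p *
        (4 * \<sigma>\<^sup>2 * (\<Sum>j = Suc j..<N. 1 / (real j)\<^sup>2) + (2 * \<sigma> / real j)\<^sup>2 * 1\<^sup>2) ^ p"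
  proof (rule trace_moment_martingale_step)
    show "finite I" using \<open>finite Perms\<close> by (simp add: I_def)
    show "transpose (S \<iota>) = S \<iota>" if "\<iota> \<in> I" for \<iota>
      using that \<open>j < N\<close> by (auto simp: I_def S_def Perms_def linear_diff[OF linear_transpose] M_sym permutes_id)
    show "transpose (X \<iota>) = X \<iota>" if "\<iota> \<in> I" for \<iota>
      using that \<open>j < N\<close> by (auto simp: I_def X_def Perms_def transpose_scalar
          linear_diff[OF linear_transpose] M_sym B \<pi>_less)
    show "norm (X \<iota> *v u) \<le> 2 * \<sigma> / real j * norm u" if \<iota>I: "\<iota> \<in> I" for \<iota> u
    proof -
      obtain \<pi> i where \<iota>: "\<iota> = (\<pi>, i)" "\<pi> permutes {..<N}" "i < N"
        using \<iota>I \<open>j < N\<close> by (auto simp: I_def Perms_def)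
      have "norm ((M (Suc j) \<pi> - B (\<pi> i)) *v u) \<le> norm (M (Suc j) \<pi> *v u) + norm (B (\<pi> i) *v u)"
        by (simp add: matrix_vector_mult_diff_rdistrib norm_triangle_ineq4)
      also have "\<dots> \<le> \<sigma> * norm u + \<sigma> * norm u"
        using \<iota> \<open>j < N\<close> by (intro add_mono M_le B_le) (auto simp: \<pi>_less)
      finally have "norm ((M (Suc j) \<pi> - B (\<pi> i)) *v u) / real j \<le> (\<sigma> * norm u + \<sigma> * norm u) / real j"
        by (rule divide_right_mono) simp
      moreover have "X \<iota> *v u = (1 / real j) *\<^sub>R ((M (Suc j) \<pi> - B (\<pi> i)) *v u)"
        by (simp only: \<iota>(1) X_def case_prod_conv scaleR_matrix_vector_assoc)
      ultimately show ?thesis by simp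
    qed
    show "(\<Sum>\<iota>\<in>I. trace (X \<iota> ** mpow (S \<iota>) k)) = 0" for k
    proof -
      \<comment> \<open>Deviations from the mean sum to zero for each permutation, and
        \<open>S\<close> does not depend on \<open>i\<close>; hence the increments are
        centered.\<close>
      have "(\<Sum>i\<le>j. X (\<pi>, i)) = 0" for \<pi>
      proof -
        have "(\<Sum>i\<le>j. M (Suc j) \<pi> - B (\<pi> i)) = real (Suc j) *\<^sub>R M (Suc j) \<pi> - (\<Sum>i\<le>j. B (\<pi> i))"
          by (simp only: sum_subtractf sum_constant_scaleR card_atMost)
        also have "\<dots> = 0"
          by (simp add: M_def lessThan_Suc_atMost del: of_nat_Suc)
        finally show ?thesis
          by (simp add: X_def scaleR_sum_right[symmetric])
      qed
      then have "(\<Sum>i\<le>j. trace (X (\<pi>, i) ** Y)) = 0" for \<pi> Y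
        by (metis (no_types, lifting) matrix_mult_sum_left sum.cong trace_sum trace_0 mat_0
            bounded_bilinear.zero_left[OF bounded_bilinear_matrix_matrix_mult])
      then show ?thesis
        unfolding I_def sum.cartesian_product[symmetric, of "\<lambda>\<pi> i. trace (X (\<pi>, i) ** mpow (S (\<pi>, i)) k)", simplified]
        by (simp add: S_def)
    qed
    show "(\<Sum>\<iota>\<in>I. trace (mpow (S \<iota>) (2 * p)))
      \<le> (fact N * real CARD('n) * real (Suc j)) * gaussian_moment p *
        (4 * \<sigma>\<^sup>2 * (\<Sum>j = Suc j..<N. 1 / (real j)\<^sup>2)) ^ p" for p
    proof -
      have "(\<Sum>\<iota>\<in>I. trace (mpow (S \<iota>) (2 * p)))
        = (\<Sum>\<pi>\<in>Perms. \<Sum>i\<le>j. trace (mpow (M (Suc j) \<pi> - M N id) (2 * p)))"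
        unfolding I_def sum.cartesian_product S_def by (simp add: case_prod_unfold)
      also have "\<dots> = real (Suc j) * (\<Sum>\<pi>\<in>Perms. trace (mpow (M (Suc j) \<pi> - M N id) (2 * p)))"
        by (simp add: sum_distrib_left)
      also have "\<dots> \<le> real (Suc j) * (fact N * real CARD('n) * gaussian_moment p *
          (4 * \<sigma>\<^sup>2 * (\<Sum>j = Suc j..<N. 1 / (real j)\<^sup>2)) ^ p)"
        unfolding Perms_def by (intro mult_left_mono step.IH) simp
      finally show ?thesis by (simp only: mult_ac)
    qed
    show "0 \<le> 4 * \<sigma>\<^sup>2 * (\<Sum>j = Suc j..<N. 1 / (real j)\<^sup>2)"
      by (intro mult_nonneg_nonneg sum_nonneg) auto
  qed (use \<open>0 \<le> \<sigma>\<close> in auto)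
  also have "4 * \<sigma>\<^sup>2 * (\<Sum>j = Suc j..<N. 1 / (real j)\<^sup>2) + (2 * \<sigma> / real j)\<^sup>2 * 1\<^sup>2
      = 4 * \<sigma>\<^sup>2 * (\<Sum>j = j..<N. 1 / (real j)\<^sup>2)"
    using \<open>j < N\<close> by (simp add: sum.atLeast_Suc_lessThan power_divide power_mult_distrib algebra_simps)
  also have "(\<Sum>\<iota>\<in>I. trace (mpow (S \<iota> + 1 *\<^sub>R X \<iota>) (2 * p)))
      = (\<Sum>\<pi>\<in>Perms. \<Sum>i\<le>j. trace (mpow (M j (\<pi> \<circ> Transposition.transpose i j) - M N id) (2 * p)))"
  proof -
    \<comment> \<open>Dropping sample \<open>i\<close> from the first \<open>j + 1\<close> amounts
      to swapping it into the last position \<open>j\<close> and keeping the first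
      \<open>j\<close>.\<close>
    have "S (\<pi>, i) + 1 *\<^sub>R X (\<pi>, i) = M j (\<pi> \<circ> Transposition.transpose i j) - M N id" if "i \<le> j" for \<pi> i
    proof -
      have "(\<Sum>k\<le>j. B ((\<pi> \<circ> Transposition.transpose i j) k)) = (\<Sum>k\<le>j. B (\<pi> k))"
        using sum.permute[OF permutes_swap_id[of i "{..j}" j], of "B \<circ> \<pi>"] that
        by (simp add: o_def)
      then have swap: "(\<Sum>k<j. B ((\<pi> \<circ> Transposition.transpose i j) k)) = (\<Sum>k\<le>j. B (\<pi> k)) - B (\<pi> i)"
        by (simp add: lessThan_Suc_atMost[symmetric] algebra_simps)
      define Z where "Z = M (Suc j) \<pi>"
      have "(\<Sum>k\<le>j. B (\<pi> k)) = real (Suc j) *\<^sub>R Z"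
        by (simp add: Z_def M_def lessThan_Suc_atMost del: of_nat_Suc)
      then have "M j (\<pi> \<circ> Transposition.transpose i j) = Z + (1 / real j) *\<^sub>R (Z - B (\<pi> i))"
        using \<open>1 \<le> j\<close> unfolding M_def swap by (simp add: algebra_simps)
      then show ?thesis by (simp add: S_def X_def Z_def)
    qed
    then show ?thesis
      unfolding I_def sum.cartesian_product by (intro sum.cong) auto
  qed
  also have "\<dots> = (\<Sum>i\<le>j. \<Sum>\<pi>\<in>Perms. trace (mpow (M j (\<pi> \<circ> Transposition.transpose i j) - M N id) (2 * p)))"
    by (rule sum.swap)
  \<comment> \<open>Composition with a transposition permutes the set of permutations, so every
    \<open>i\<close> contributes the same sum.\<close>
  also have "\<dots> = (\<Sum>i\<le>j. \<Sum>\<pi>\<in>Perms. trace (mpow (M j \<pi> - M N id) (2 * p)))"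
    unfolding Perms_def using \<open>j < N\<close>
    by (intro sum.cong refl sum_permutations_compose_right[symmetric] permutes_swap_id) auto
  also have "\<dots> = real (Suc j) * (\<Sum>\<pi>\<in>Perms. trace (mpow (M j \<pi> - M N id) (2 * p)))"
    by simp
  finally have "real (Suc j) * (\<Sum>\<pi>\<in>Perms. trace (mpow (M j \<pi> - M N id) (2 * p)))
      \<le> real (Suc j) * (fact N * real CARD('n) * gaussian_moment p *
        (4 * \<sigma>\<^sup>2 * (\<Sum>j = j..<N. 1 / (real j)\<^sup>2)) ^ p)"
    by (simp only: mult_ac)
  then show ?case
    unfolding Perms_def by (rule mult_left_le_imp_le) simp
qed

section \<open>Hermitian dilation of rectangular matrices\<close>

definition dilation :: "real^'d2^'d1 \<Rightarrow> real^('d1 + 'd2)^('d1 + 'd2)" where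
  "dilation A = (\<chi> i j. case (i, j) of (Inl a, Inr b) \<Rightarrow> A $ a $ b | (Inr b, Inl a) \<Rightarrow> A $ a $ b | _ \<Rightarrow> 0)"

lemma transpose_dilation: "transpose (dilation A) = dilation A"
  by (auto simp: vec_eq_iff transpose_def dilation_def split: sum.splits)

lemma linear_dilation: "linear dilation"
  by (rule linearI) (auto simp: vec_eq_iff dilation_def split: sum.splits)

lemma sum_UNIV_sum_type:
  "(\<Sum>i\<in>UNIV. f i) = (\<Sum>a\<in>UNIV. f (Inl a)) + (\<Sum>b\<in>UNIV. f (Inr b))"
  for f :: "'a::finite + 'b::finite \<Rightarrow> 'c::comm_monoid_add"
  by (simp add: UNIV_Plus_UNIV[symmetric] sum.Plus del: UNIV_Plus_UNIV)

lemma dilation_vector_mult: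
  "dilation A *v u = (\<chi> i. case i of Inl a \<Rightarrow> (A *v (\<chi> b. u $ Inr b)) $ a
    | Inr b \<Rightarrow> ((\<chi> a. u $ Inl a) v* A) $ b)"
  by (auto simp: vec_eq_iff dilation_def matrix_vector_mult_def vector_matrix_mult_def
      sum_UNIV_sum_type mult.commute split: sum.splits)

lemma norm_vec_sum_type:
  "(norm u)\<^sup>2 = (norm (\<chi> a. u $ Inl a))\<^sup>2 + (norm (\<chi> b. u $ Inr b))\<^sup>2"
  for u :: "real^('a::finite + 'b::finite)"
  by (simp add: power2_norm_eq_inner inner_vec_def sum_UNIV_sum_type)

lemma norm_dilation_vector_mult:
  "(norm (dilation A *v u))\<^sup>2
    = (norm (A *v (\<chi> b. u $ Inr b)))\<^sup>2 + (norm ((\<chi> a. u $ Inl a) v* A))\<^sup>2"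
  by (subst norm_vec_sum_type) (simp add: dilation_vector_mult)

lemma norm_vector_matrix_mult_le:
  fixes A :: "real^'n^'m"
  assumes "\<And>x. norm (A *v x) \<le> \<sigma> * norm x"
  shows "norm (y v* A) \<le> \<sigma> * norm y"
proof (cases "y v* A = 0")
  case True
  \<comment> \<open>A unit vector in the hypothesis shows that \<sigma> is nonnegative.\<close>
  have "0 \<le> \<sigma> * norm (axis undefined 1 :: real^'n)"
    using assms order_trans norm_ge_zero by metis
  then have "0 \<le> \<sigma>" by simp
  then show ?thesis using True by simp
next
  case False
  have "norm (y v* A) * norm (y v* A) = y \<bullet> (A *v (y v* A))"
    by (simp add: dot_lmul_matrix[symmetric] power2_norm_eq_inner[symmetric] power2_eq_square)
  also have "\<dots> \<le> norm y * (\<sigma> * norm (y v* A))"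
    by (rule order_trans[OF norm_cauchy_schwarz]) (simp add: assms mult_left_mono)
  finally show ?thesis
    using False by (simp add: mult_ac)
qed

text \<open>The dilation applies \<open>A\<close> to one block and its transpose to the other; both
  obey the bound \<sigma>, and the images lie in orthogonal blocks.\<close>

lemma norm_dilation_vector_mult_le:
  fixes A :: "real^'d2^'d1"
  assumes A: "\<And>x. norm (A *v x) \<le> \<sigma> * norm x" and "0 \<le> \<sigma>"
  shows "norm (dilation A *v u) \<le> \<sigma> * norm u"
proof (rule power2_le_imp_le)
  have "(norm (dilation A *v u))\<^sup>2
      = (norm (A *v (\<chi> b. u $ Inr b)))\<^sup>2 + (norm ((\<chi> a. u $ Inl a) v* A))\<^sup>2"
    by (rule norm_dilation_vector_mult)
  also have "\<dots> \<le> (\<sigma> * norm (\<chi> b. u $ Inr b))\<^sup>2 + (\<sigma> * norm (\<chi> a. u $ Inl a))\<^sup>2"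
    by (intro add_mono power_mono A norm_vector_matrix_mult_le) simp_all
  also have "\<dots> = (\<sigma> * norm u)\<^sup>2"
    by (simp add: norm_vec_sum_type[of u] power_mult_distrib algebra_simps)
  finally show "(norm (dilation A *v u))\<^sup>2 \<le> (\<sigma> * norm u)\<^sup>2" .
qed (simp add: \<open>0 \<le> \<sigma>\<close>)

lemma spectral_norm_le_onorm_dilation:
  fixes A :: "real^'d2^'d1"
  shows "spectral_norm A \<le> onorm ((*v) (dilation A))"
  unfolding spectral_norm_def
proof (rule onorm_le)
  fix x :: "real^'d2"
  \<comment> \<open>On vectors padded by zeros in the first block, the dilation acts as
    \<open>A\<close>.\<close>
  define u :: "real^('d1 + 'd2)" where "u = (\<chi> i. case i of Inl a \<Rightarrow> 0 | Inr b \<Rightarrow> x $ b)"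
  have u: "(\<chi> b. u $ Inr b) = x" "(\<chi> a. u $ Inl a) = 0"
    by (simp_all add: u_def vec_eq_iff)
  have "(norm (A *v x))\<^sup>2 = (norm (dilation A *v u))\<^sup>2"
    by (simp add: norm_dilation_vector_mult u)
  then have "norm (A *v x) = norm (dilation A *v u)" by simp
  also have "\<dots> \<le> onorm ((*v) (dilation A)) * norm u"
    by (intro onorm matrix_vector_mul_bounded_linear)
  also have "norm u = norm x"
    using norm_vec_sum_type[of u] by (simp add: u)
  finally show "norm (A *v x) \<le> onorm ((*v) (dilation A)) * norm x" .
qed

section \<open>The tail bound for the sample mean\<close>

theorem theorem4:
  fixes A :: "nat \<Rightarrow> real^'d2^'d1"
    and N n :: nat and \<sigma> \<epsilon> :: real
  assumes "\<sigma> > 0"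
    and "\<forall>i<N. spectral_norm (A i) \<le> \<sigma>"
    and "1 \<le> n" and "n < N"
    and "\<epsilon> > 0"
  defines "\<mu> \<equiv> (1 / real N) *\<^sub>R (\<Sum>i<N. A i)"
  shows "measure_pmf.prob (unif_perm N)
           {\<pi>. spectral_norm ((1 / real n) *\<^sub>R (\<Sum>i<n. A (\<pi> i)) - \<mu>) \<ge> \<epsilon>}
         \<le> 2 * real (CARD('d1) + CARD('d2)) *
            exp (- (real n * \<epsilon>^2) /
                 (8 * \<sigma>^2 * (1 + 1 / real n) * (1 - real n / real N)))"
proof -
  define D where "D \<pi> = (1 / real n) *\<^sub>R (\<Sum>i<n. A (\<pi> i)) - \<mu>" for \<pi>
  define Perms where "Perms = {\<pi>. \<pi> permutes {..<N}}"
  have Perms: "finite Perms" "card Perms = fact N" "Perms \<noteq> {}"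
    unfolding Perms_def using permutes_id[of "{..<N}"]
    by (auto simp: finite_permutations card_permutations[OF card_lessThan] simp del: permutes_id)
  define E where "E = {\<pi>. \<epsilon> \<le> spectral_norm (D \<pi>)}"
  define P where "P = measure_pmf.prob (unif_perm N) E"
  have P_eq: "P = real (card (Perms \<inter> E)) / fact N"
    unfolding P_def unif_perm_def Perms_def[symmetric]
    using measure_pmf_of_set[of Perms E] Perms by simp
  define v where "v = 4 * \<sigma>\<^sup>2 * (\<Sum>j = n..<N. 1 / (real j)\<^sup>2)"
  have "0 < v"
    unfolding v_def using assms(1,3,4) by (intro mult_pos_pos sum_pos) auto
  have A_le: "norm (A i *v x) \<le> \<sigma> * norm x" if "i < N" for i x
  proof -
    have "norm (A i *v x) \<le> spectral_norm (A i) * norm x"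
      unfolding spectral_norm_def by (intro onorm matrix_vector_mul_bounded_linear)
    also have "\<dots> \<le> \<sigma> * norm x"
      using assms(2) that by (intro mult_right_mono) auto
    finally show ?thesis .
  qed
  have dilation_D: "dilation (D \<pi>) = (1 / real n) *\<^sub>R (\<Sum>i<n. dilation (A (\<pi> i)))
      - (1 / real N) *\<^sub>R (\<Sum>i<N. dilation (A (id i)))" for \<pi>
    by (simp add: D_def \<mu>_def linear_diff[OF linear_dilation] linear_cmul[OF linear_dilation]
        linear_sum[OF linear_dilation])
  have "P * \<epsilon> ^ (2 * p) \<le> real (CARD('d1) + CARD('d2)) * gaussian_moment p * v ^ p" for p
  proof -
    \<comment> \<open>Markov's inequality in counting form; extending the sum to all permutations is
      allowed because even trace moments are nonnegative.\<close>
    have "real (card (Perms \<inter> E)) * \<epsilon> ^ (2 * p) = (\<Sum>\<pi>\<in>Perms \<inter> E. \<epsilon> ^ (2 * p))"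
      by simp
    also have "\<dots> \<le> (\<Sum>\<pi>\<in>Perms \<inter> E. trace (mpow (dilation (D \<pi>)) (2 * p)))"
      using assms(5) spectral_norm_le_onorm_dilation
      by (intro sum_mono trace_mpow_ge_onorm transpose_dilation) (auto simp: E_def intro: order_trans)
    also have "\<dots> \<le> (\<Sum>\<pi>\<in>Perms. trace (mpow (dilation (D \<pi>)) (2 * p)))"
      using Perms(1) by (intro sum_mono2) (auto simp: trace_mpow_even transpose_dilation)
    also have "\<dots> \<le> fact N * real CARD('d1 + 'd2) * gaussian_moment p * v ^ p"
      unfolding Perms_def dilation_D v_def
      by (rule trace_moment_sampling)
        (use assms(1,3,4) in \<open>auto simp: transpose_dilation intro!: norm_dilation_vector_mult_le A_le\<close>)
    finally show ?thesis
      by (simp add: P_eq field_simps)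
  qed
  then have "P \<le> 2 * real (CARD('d1) + CARD('d2)) * exp (- \<epsilon>\<^sup>2 / (2 * v))"
    by (rule gaussian_moments_imp_tail[OF _ \<open>0 < v\<close>]) (simp add: P_def)
  also have "\<dots> \<le> 2 * real (CARD('d1) + CARD('d2)) *
      exp (- (real n * \<epsilon>\<^sup>2) / (8 * \<sigma>\<^sup>2 * (1 + 1 / real n) * (1 - real n / real N)))"
  proof -
    \<comment> \<open>The closed-form bound for the variance proxy \<open>v\<close>. The 8 in the
      theorem is the 4 from the squared increments times the 2 in the Gaussian exponent.\<close>
    define V where "V = 4 * \<sigma>\<^sup>2 * ((1 + 1 / real n) * (1 / real n - 1 / real N))"
    have "v \<le> V"
      unfolding v_def V_def using assms(3,4) by (intro mult_left_mono sum_inverse_squares_le) auto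
    have nV: "8 * \<sigma>\<^sup>2 * (1 + 1 / real n) * (1 - real n / real N) = real n * (2 * V)"
    proof -
      have "1 - real n / real N = real n * (1 / real n - 1 / real N)"
        using assms(3) by (simp add: right_diff_distrib)
      then show ?thesis by (simp add: V_def)
    qed
    have "\<epsilon>\<^sup>2 / (2 * V) \<le> \<epsilon>\<^sup>2 / (2 * v)"
      using \<open>v \<le> V\<close> \<open>0 < v\<close> by (intro divide_left_mono) auto
    then show ?thesis
      unfolding nV using assms(3) by (intro mult_left_mono) auto
  qed
  finally show ?thesis
    unfolding P_def E_def D_def .
qed

end
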